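(* Let $(X,\mathcal A,\mu,T)$ be a measure preserving system, let $\ell\in\mathbb N$, and let $a_1,\dots,a_\ell$ be distinct non-zero integers. Then $T$ is strongly mixing if and only if for any $A_0,\dots,A_\ell\in\mathcal A$ and any $\epsilon>0$, the set $$R^{a_1,\dots,a_\ell}_\epsilon(A_0,\dots,A_\ell)=\Big\{n\in\mathbb Z : \Big|\mu(A_0\cap T^{a_1n}A_1\cap\cdots\cap T^{a_\ell n}A_\ell)-\prod_{j=0}^\ell\mu(A_j)\Big|<\epsilon\Big\}$$ is $\Sigma_\ell^*$.
   Context: $\mathbb N=\{1,2,\dots\}$. Here $(X,\mathcal A,\mu)$ is a separable probability space (by standing assumption regular: $X$ is a compact metric space and $\mathcal A=\mathrm{Borel}(X)$) and $T:X\to X$ is an invertible $\mu$-preserving transformation, generating the $\mathbb Z$-action $(T^n)_{n\in\mathbb Z}$. $T$ is strongly mixing if $\lim_{|n|\to\infty}\mu(A_0\cap T^nA_1)=\mu(A_0)\mu(A_1)$ for all $A_0,A_1\in\mathcal A$. A set $E\subseteq\mathbb Z$ is a $\Sigma_m$ set if $E=\{n^{(1)}_{k_1}+\cdots+n^{(m)}_{k_m} : k_1<\cdots<k_m\}$ (with $k_1,\dots,k_m\in\mathbb N$), where for each $j\in\{1,\dots,m\}$, $(n^{(j)}_k)_{k\in\mathbb N}$ is a sequence in $\mathbb Z$ with $\lim_{k\to\infty}|n^{(j)}_k|=\infty$. A subset of $\mathbb Z$ is $\Sigma_m^*$ if it has non-empty intersection with every $\Sigma_m$ set. *)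

theory Defs
  imports "HOL-Probability.Probability"
begin

text \<open>
  The compact metric space is the carrier \<open>space M\<close>, a compact subset of a metric type; taking
  the carrier to be the whole type is the special case \<open>space M = UNIV\<close>. Separability of the
  probability space is automatic in this setting.
\<close>

locale invertible_mps = prob_space M
  for M :: "'a::metric_space measure" and T :: "'a \<Rightarrow> 'a" +
  assumes compact_space: "compact (space M)"
    and sets_borel: "sets M = sets (restrict_space borel (space M))"
    and T_bij: "bij_betw T (space M) (space M)"
    and T_measurable: "T \<in> measurable M M"
    and T_inv_measurable: "inv_into (space M) T \<in> measurable M M"
    and T_preserves: "distr M M T = M"

text \<open>
  The integer power \<open>T\<^sup>n\<close> of a bijection \<open>T\<close> of \<open>X\<close>. It is meaningful on \<open>X\<close> only.
\<close>

definition int_pow_on :: "'a set \<Rightarrow> ('a \<Rightarrow> 'a) \<Rightarrow> int \<Rightarrow> 'a \<Rightarrow> 'a" where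
  "int_pow_on X T n = (if 0 \<le> n then T ^^ nat n else inv_into X T ^^ nat (- n))"

text \<open>The filter \<open>filtercomap abs at_top\<close> on the integers expresses \<open>\<bar>n\<bar> \<longrightarrow> \<infinity>\<close>.\<close>

definition strongly_mixing :: "'a measure \<Rightarrow> ('a \<Rightarrow> 'a) \<Rightarrow> bool" where
  "strongly_mixing M T \<longleftrightarrow>
     (\<forall>A0\<in>sets M. \<forall>A1\<in>sets M.
        ((\<lambda>n::int. measure M (A0 \<inter> int_pow_on (space M) T n ` A1))
           \<longlongrightarrow> measure M A0 * measure M A1) (filtercomap abs at_top))"

text \<open>
  \<open>s j k\<close> is the \<open>k\<close>-th term of the \<open>j\<close>-th sequence. Indices \<open>j\<close> and \<open>k\<close> start from 1; values at
  index 0 play no role.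
\<close>

definition is_Sigma :: "nat \<Rightarrow> int set \<Rightarrow> bool" where
  "is_Sigma m E \<longleftrightarrow>
     (\<exists>s :: nat \<Rightarrow> nat \<Rightarrow> int.
        (\<forall>j\<in>{1..m}. filterlim (\<lambda>k. \<bar>s j k\<bar>) at_top sequentially) \<and>
        E = {\<Sum>j=1..m. s j (k j) | k :: nat \<Rightarrow> nat.
               strict_mono_on {1..m} k \<and> (\<forall>j\<in>{1..m}. 1 \<le> k j)})"

definition is_Sigma_star :: "nat \<Rightarrow> int set \<Rightarrow> bool" where
  "is_Sigma_star m D \<longleftrightarrow> (\<forall>E. is_Sigma m E \<longrightarrow> D \<inter> E \<noteq> {})"

definition return_set ::
  "'a measure \<Rightarrow> ('a \<Rightarrow> 'a) \<Rightarrow> nat \<Rightarrow> (nat \<Rightarrow> int) \<Rightarrow> real \<Rightarrow> (nat \<Rightarrow> 'a set) \<Rightarrow> int set" where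
  "return_set M T l a \<epsilon> A =
     {n :: int. \<bar>measure M (A 0 \<inter> (\<Inter>j\<in>{1..l}. int_pow_on (space M) T (a j * n) ` A j))
                - (\<Prod>j=0..l. measure M (A j))\<bar> < \<epsilon>}"

end

theory Submission
  imports Defs "HOL-Library.Ramsey"
begin

text \<open>
  Both directions rest on one quantitative fact about a single probability space, a form of
  Bessel's inequality: if \<open>V\<^sub>1, \<dots>, V\<^sub>N\<close> all have probability close to \<open>c\<close> and their pairwise
  intersections have probability close to \<open>c\<^sup>2\<close>, then for every event \<open>G\<close> the average over \<open>i\<close> of
  \<open>\<bar>P(V\<^sub>i \<inter> G) - c P(G)\<bar>\<close> is small, since the functions \<open>1\<^bsub>V i\<^esub> - c\<close> are almost orthogonal
  (lemma \<open>quasi_independent_events_small_correlation\<close>).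

  \<^emph>\<open>Strong mixing gives \<open>\<Sigma>\<^sub>\<ell>\<^sup>*\<close>.\<close> The proof is an induction on \<open>\<ell>\<close>. After translation by a
  power of \<open>T\<close>, an intersection of \<open>\<ell> + 1\<close> moving events is \<open>A\<^sub>0 \<inter> V\<^sub>n\<close>, where \<open>V\<^sub>n\<close>
  is an intersection of \<open>\<ell>\<close> moving events. In \<open>n = s\<^sub>1(k\<^sub>1) + m\<close> let \<open>k\<^sub>1\<close> run through \<open>N\<close> values and
  keep the remaining part \<open>m\<close> the same for all of them. The intersection of the \<open>V\<^sub>n\<close> for two values
  of \<open>k\<^sub>1\<close> is again an intersection of \<open>\<ell>\<close> events moved by \<open>m\<close>, and \<open>m\<close> ranges over a \<open>\<Sigma>\<^bsub>\<ell> - 1\<^esub>\<close> set, so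
  that the induction hypothesis evaluates it; mixing in \<open>k\<^sub>1\<close> alone shows that the values are those of
  independent events. Hence the \<open>V\<^sub>n\<close> are almost independent of each other, and on average over \<open>k\<^sub>1\<close>
  they are almost independent of \<open>A\<^sub>0\<close>. Since many intersections have to be evaluated for the same
  \<open>m\<close>, the induction is carried out for finitely many tuples of events at once
  (theorem \<open>strongly_mixing_imp_multiple_mixing_along_sums\<close>).

  \<^emph>\<open>\<open>\<Sigma>\<^sub>\<ell>\<^sup>*\<close> gives strong mixing.\<close> Taking all but two of the events to be the whole space reduces the
  hypothesis to the correlations \<open>P(A \<inter> T\<^bsup>cn\<^esup> B)\<close>, and the point is to replace \<open>\<ell>\<close> by \<open>1\<close>. If the set of
  times of approximate independence is \<open>\<Sigma>\<^bsub>2m\<^esub>\<^sup>*\<close>, then it is \<open>\<Sigma>\<^sub>m\<^sup>*\<close>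
  (lemma \<open>Sigma_star_mixing_returns_halve\<close>): differences of elements of a \<open>\<Sigma>\<^sub>m\<close> set that come from
  successive blocks of indices lie in a \<open>\<Sigma>\<^bsub>2m\<^esub>\<close> set; Ramsey's theorem, after restriction to an
  infinite set of indices, makes all of them times of approximate independence of \<open>B\<close> from itself,
  and then the translates of \<open>B\<close> are almost independent of each other, hence on average of \<open>A\<close>.
  As every \<open>\<Sigma>\<^bsub>m + 1\<^esub>\<close> set contains a \<open>\<Sigma>\<^sub>m\<close> set, \<open>\<Sigma>\<^sub>\<ell>\<^sup>*\<close> implies
  \<open>\<Sigma>\<^sub>q\<^sup>*\<close> for \<open>q = 2\<^sup>\<ell>\<close>, and halving \<open>\<ell>\<close> times leads to \<open>\<Sigma>\<^sub>1\<^sup>*\<close>. Being \<open>\<Sigma>\<^sub>1\<^sup>*\<close> is the same as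
  having bounded complement.
\<close>

section \<open>Almost independent events\<close>

context prob_space
begin

definition quasi_independent :: "'i set \<Rightarrow> ('i \<Rightarrow> 'a set) \<Rightarrow> real \<Rightarrow> real \<Rightarrow> bool" where
  "quasi_independent I V c \<delta> \<longleftrightarrow>
     0 \<le> c \<and> c \<le> 1 \<and>
     (\<forall>i\<in>I. V i \<in> events \<and> \<bar>prob (V i) - c\<bar> \<le> \<delta>) \<and>
     (\<forall>i\<in>I. \<forall>j\<in>I. i \<noteq> j \<longrightarrow> \<bar>prob (V i \<inter> V j) - c\<^sup>2\<bar> \<le> \<delta>)"

text \<open>
  With signs \<open>\<sigma>\<^sub>i\<close> chosen so that the left-hand sum is the integral of \<open>u\<close> over \<open>G\<close> for
  \<open>u = \<Sum>\<^sub>i \<sigma>\<^sub>i (1\<^bsub>V i\<^esub> - c)\<close>, the square of that integral is at most the integral of \<open>u\<^sup>2\<close>. Expanding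
  \<open>u\<^sup>2\<close>, each diagonal term contributes at most \<open>1 + \<delta>\<close>, and each off-diagonal term at most \<open>3 \<delta>\<close>,
  one \<open>\<delta>\<close> for each of \<open>P(V\<^sub>i \<inter> V\<^sub>j)\<close>, \<open>P(V\<^sub>i)\<close> and \<open>P(V\<^sub>j)\<close>.
\<close>

lemma sum_abs_correlation_square_le:
  fixes \<delta> :: real
  assumes "finite I" and qi: "quasi_independent I V c \<delta>" and G: "G \<in> events"
  shows "(\<Sum>i\<in>I. \<bar>prob (V i \<inter> G) - c * prob G\<bar>)\<^sup>2 \<le> card I + 3 * (card I)\<^sup>2 * \<delta>"
proof (cases "I = {}")
  case False
  have c: "0 \<le> c" "c \<le> 1"
    and V: "\<And>i. i \<in> I \<Longrightarrow> V i \<in> events"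
    and single: "\<And>i. i \<in> I \<Longrightarrow> \<bar>prob (V i) - c\<bar> \<le> \<delta>"
    and pair: "\<And>i j. i \<in> I \<Longrightarrow> j \<in> I \<Longrightarrow> i \<noteq> j \<Longrightarrow> \<bar>prob (V i \<inter> V j) - c\<^sup>2\<bar> \<le> \<delta>"
    using qi unfolding quasi_independent_def by blast+
  from False obtain i0 where "i0 \<in> I" by blast
  then have \<delta>: "0 \<le> \<delta>" using single[of i0] by linarith
  define v where "v i x = indicator (V i) x - c" for i x
  define \<sigma> where "\<sigma> i = sgn (prob (V i \<inter> G) - c * prob G)" for i
  define u where "u x = (\<Sum>i\<in>I. \<sigma> i * v i x)" for x
  have intG: "integrable M (indicator G :: _ \<Rightarrow> real)"
    using G by (simp add: integrable_indicator_iff emeasure_eq_measure)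
  have intV: "integrable M (indicator (V i) :: _ \<Rightarrow> real)" if "i \<in> I" for i
    using V[OF that] by (simp add: integrable_indicator_iff emeasure_eq_measure)
  have intVV: "integrable M (indicator (V i \<inter> V j) :: _ \<Rightarrow> real)" if "i \<in> I" "j \<in> I" for i j
    using V[OF that(1)] V[OF that(2)] by (simp add: integrable_indicator_iff emeasure_eq_measure)
  have intVG: "integrable M (indicator (V i \<inter> G) :: _ \<Rightarrow> real)" if "i \<in> I" for i
    using V[OF that] G by (simp add: integrable_indicator_iff emeasure_eq_measure)
  have vG: "v i x * indicator G x = indicator (V i \<inter> G) x - c * indicator G x" for i x
    by (simp add: v_def indicator_inter_arith algebra_simps)
  have vv: "v i x * v j x = indicator (V i \<inter> V j) x - c * indicator (V i) x - c * indicator (V j) x + c\<^sup>2" for i j x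
    by (simp add: v_def indicator_inter_arith algebra_simps power2_eq_square)
  have int_vG: "integrable M (\<lambda>x. v i x * indicator G x)" if "i \<in> I" for i
    unfolding vG using intVG[OF that] intG by simp
  have int_vv: "integrable M (\<lambda>x. v i x * v j x)" if "i \<in> I" "j \<in> I" for i j
    unfolding vv using intVV[OF that] intV[OF that(1)] intV[OF that(2)] by simp
  have E_vG: "(\<integral>x. v i x * indicator G x \<partial>M) = prob (V i \<inter> G) - c * prob G" if "i \<in> I" for i
    unfolding vG using intVG[OF that] intG V[OF that] G by simp
  have E_vv: "(\<integral>x. v i x * v j x \<partial>M) = prob (V i \<inter> V j) - c * prob (V i) - c * prob (V j) + c\<^sup>2"
    if "i \<in> I" "j \<in> I" for i j
    unfolding vv using intVV[OF that] intV[OF that(1)] intV[OF that(2)] V[OF that(1)] V[OF that(2)]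
    by (simp add: prob_space)
  have sigma_abs: "\<sigma> i * (prob (V i \<inter> G) - c * prob G) = \<bar>prob (V i \<inter> G) - c * prob G\<bar>" for i
    by (simp add: \<sigma>_def sgn_if)
  have sig1: "\<bar>\<sigma> i * \<sigma> j\<bar> \<le> 1" for i j by (auto simp: \<sigma>_def sgn_if)
  have uG: "u x * indicator G x = (\<Sum>i\<in>I. \<sigma> i * (v i x * indicator G x))" for x
    by (simp add: u_def sum_distrib_right mult.assoc)
  have uu: "(u x)\<^sup>2 = (\<Sum>i\<in>I. \<Sum>j\<in>I. (\<sigma> i * \<sigma> j) * (v i x * v j x))" for x
    by (simp add: u_def power2_eq_square sum_product mult_ac)
  have int_uG: "integrable M (\<lambda>x. u x * indicator G x)"
    unfolding uG using int_vG by (intro Bochner_Integration.integrable_sum) simp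
  have int_uu: "integrable M (\<lambda>x. (u x)\<^sup>2)"
    unfolding uu using int_vv by (intro Bochner_Integration.integrable_sum) simp
  have E_uG: "(\<integral>x. u x * indicator G x \<partial>M) = (\<Sum>i\<in>I. \<bar>prob (V i \<inter> G) - c * prob G\<bar>)"
    unfolding uG using int_vG E_vG by (simp add: sigma_abs)
  have E_uu: "(\<integral>x. (u x)\<^sup>2 \<partial>M) = (\<Sum>i\<in>I. \<Sum>j\<in>I. (\<sigma> i * \<sigma> j) * (\<integral>x. v i x * v j x \<partial>M))"
    unfolding uu using int_vv by (simp add: Bochner_Integration.integrable_sum)
  have term_le: "(\<sigma> i * \<sigma> j) * (\<integral>x. v i x * v j x \<partial>M) \<le> (if i = j then 1 else 0) + 3 * \<delta>"
    if ij: "i \<in> I" "j \<in> I" for i j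
  proof -
    have "(\<sigma> i * \<sigma> j) * (\<integral>x. v i x * v j x \<partial>M) \<le> \<bar>\<integral>x. v i x * v j x \<partial>M\<bar>"
    proof -
      have "\<bar>\<sigma> i * \<sigma> j\<bar> * \<bar>\<integral>x. v i x * v j x \<partial>M\<bar> \<le> 1 * \<bar>\<integral>x. v i x * v j x \<partial>M\<bar>"
        using sig1[of i j] by (intro mult_right_mono) simp_all
      then show ?thesis
        using abs_ge_self[of "(\<sigma> i * \<sigma> j) * (\<integral>x. v i x * v j x \<partial>M)"] by (simp only: abs_mult)
    qed
    also have "\<dots> \<le> (if i = j then 1 else 0) + 3 * \<delta>"
    proof (cases "i = j")
      case True
      have "prob (V i) - c * prob (V i) - c * prob (V i) + c\<^sup>2 = (1 - c) * (prob (V i) - c) + c * (1 - prob (V i))"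
        by (simp add: algebra_simps power2_eq_square)
      moreover have "\<bar>(1 - c) * (prob (V i) - c)\<bar> \<le> \<delta>"
        using mult_mono[of "\<bar>1 - c\<bar>" 1 "\<bar>prob (V i) - c\<bar>" \<delta>] single[OF ij(1)] c by (simp add: abs_mult)
      moreover have "\<bar>c * (1 - prob (V i))\<bar> \<le> 1"
        using mult_mono[of c 1 "1 - prob (V i)" 1] c by (simp add: abs_mult)
      ultimately show ?thesis using E_vv[OF ij] True \<delta> by simp
    next
      case ne: False
      have *: "\<bar>c * (prob (V i) - c)\<bar> \<le> \<delta>" if "i \<in> I" for i
        using mult_mono[of c 1 "\<bar>prob (V i) - c\<bar>" \<delta>] single[OF that] c by (simp add: abs_mult)
      have "prob (V i \<inter> V j) - c * prob (V i) - c * prob (V j) + c\<^sup>2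
          = (prob (V i \<inter> V j) - c\<^sup>2) - c * (prob (V i) - c) - c * (prob (V j) - c)"
        by (simp add: algebra_simps power2_eq_square)
      then show ?thesis using E_vv[OF ij] *[OF ij(1)] *[OF ij(2)] pair[OF ij ne] ne by simp
    qed
    finally show ?thesis .
  qed
  have "(\<Sum>i\<in>I. \<bar>prob (V i \<inter> G) - c * prob G\<bar>)\<^sup>2 = (\<integral>x. u x * indicator G x \<partial>M)\<^sup>2"
    using E_uG by simp
  also have "\<dots> \<le> (\<integral>x. (u x * indicator G x)\<^sup>2 \<partial>M)"
  proof -
    have sq: "(u x * indicator G x)\<^sup>2 = (u x)\<^sup>2 * indicator G x" for x
      by (simp add: indicator_def)
    have "integrable M (\<lambda>x. (u x * indicator G x)\<^sup>2)"
      unfolding sq using integrable_mult_indicator[OF G int_uu] by (simp add: mult.commute)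
    then show ?thesis
      using variance_eq[OF int_uG] variance_positive[of "\<lambda>x. u x * indicator G x"] by simp
  qed
  also have "\<dots> \<le> (\<integral>x. (u x)\<^sup>2 \<partial>M)"
    by (rule integral_mono'[OF int_uu]) (auto simp: indicator_def)
  also have "\<dots> \<le> (\<Sum>i\<in>I. \<Sum>j\<in>I. (if i = j then 1 else 0) + 3 * \<delta>)"
    unfolding E_uu by (intro sum_mono term_le)
  also have "\<dots> = card I + 3 * (card I)\<^sup>2 * \<delta>"
    using \<open>finite I\<close> by (simp add: sum.distrib power2_eq_square algebra_simps)
  finally show ?thesis .
qed simp

text \<open>
  The number \<open>N\<close> and the tolerance \<open>\<delta>\<close> depend on \<open>\<epsilon>\<close> alone. This uniformity makes it possible to fix
  them before the events are constructed, and to treat several families of events with the same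
  index set.
\<close>

lemma quasi_independent_events_small_correlation:
  fixes \<epsilon> :: real
  assumes "0 < \<epsilon>"
  shows "\<exists>N>0. \<exists>\<delta>>0. \<forall>(I :: 'i set) V c. \<forall>G\<in>events.
    finite I \<and> card I = N \<and> quasi_independent I V c \<delta> \<longrightarrow> (\<Sum>i\<in>I. \<bar>prob (V i \<inter> G) - c * prob G\<bar>) < \<epsilon> * N"
proof -
  obtain N :: nat where N: "2 / \<epsilon>\<^sup>2 < N" using reals_Archimedean2 by blast
  have "0 < 2 / \<epsilon>\<^sup>2" using assms by simp
  then have "0 < real N" using N by linarith
  have "(\<Sum>i\<in>I. \<bar>prob (V i \<inter> G) - c * prob G\<bar>) < \<epsilon> * N"
    if *: "finite I" "card I = N" "quasi_independent I V c (\<epsilon>\<^sup>2 / 6)" "G \<in> events" for I :: "'i set" and V c G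
  proof -
    have "(\<Sum>i\<in>I. \<bar>prob (V i \<inter> G) - c * prob G\<bar>)\<^sup>2 \<le> N + 3 * (real N)\<^sup>2 * (\<epsilon>\<^sup>2 / 6)"
      using sum_abs_correlation_square_le[OF *(1,3,4)] *(2) by simp
    also have "\<dots> < (\<epsilon> * N)\<^sup>2"
    proof -
      have "2 < \<epsilon>\<^sup>2 * N" using N assms by (simp add: field_simps)
      then have "2 * real N < \<epsilon>\<^sup>2 * N * N" using \<open>0 < real N\<close> by (intro mult_strict_right_mono)
      then show ?thesis by (simp add: power2_eq_square algebra_simps)
    qed
    finally show ?thesis
      using assms by (intro power_less_imp_less_base[of _ 2 "\<epsilon> * N"]) auto
  qed
  moreover have "0 < N" "0 < \<epsilon>\<^sup>2 / 6" using \<open>0 < real N\<close> assms by auto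
  ultimately show ?thesis by blast
qed

end

section \<open>The group of powers of an invertible transformation\<close>

context invertible_mps
begin

abbreviation X where "X \<equiv> space M"
abbreviation P where "P \<equiv> int_pow_on (space M) T"

text \<open>
  Preimages are used in place of the images \<open>T\<^sup>n A\<close> because they commute with intersections and
  stay measurable without further argument; \<open>image_P\<close> below translates between the two.
\<close>

definition pre :: "int \<Rightarrow> 'a set \<Rightarrow> 'a set" where
  "pre n A = P n -` A \<inter> X"

lemma inv_in: "x \<in> X \<Longrightarrow> inv_into X T x \<in> X"
  using T_bij by (metis bij_betw_def inv_into_into)

lemma P_measurable: "P n \<in> measurable M M"
  unfolding int_pow_on_def
  by (auto intro!: measurable_compose_n T_measurable T_inv_measurable)

lemma P_in: "x \<in> X \<Longrightarrow> P n x \<in> X"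
  using measurable_space[OF P_measurable] by blast

lemma P_0 [simp]: "P 0 x = x"
  by (simp add: int_pow_on_def)

lemma P_Suc: "x \<in> X \<Longrightarrow> P (n + 1) x = T (P n x)"
proof (cases "0 \<le> n")
  case True
  then show ?thesis by (simp add: int_pow_on_def nat_add_distrib)
next
  case False
  assume x: "x \<in> X"
  obtain k where k: "n = - int (Suc k)" using False by (metis int_cases not_less of_nat_0_le_iff)
  have "T (P n x) = P (- int k) x"
  proof -
    have "(inv_into X T ^^ k) x \<in> X" using x inv_in by (induction k) auto
    then have "T (inv_into X T ((inv_into X T ^^ k) x)) = (inv_into X T ^^ k) x"
      using T_bij by (simp add: bij_betw_inv_into_right)
    then show ?thesis by (auto simp: k int_pow_on_def nat_add_distrib simp del: of_nat_Suc)
  qed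
  moreover have "n + 1 = - int k" using k by simp
  ultimately show ?thesis by simp
qed

lemma P_pred: assumes x: "x \<in> X" shows "P (n - 1) x = inv_into X T (P n x)"
proof -
  have "inv_into X T (P n x) = inv_into X T (T (P (n - 1) x))" using P_Suc[OF x, of "n - 1"] by simp
  then show ?thesis using T_bij P_in[OF x] by (simp add: bij_betw_inv_into_left)
qed

lemma P_add: assumes x: "x \<in> X" shows "P (m + n) x = P m (P n x)"
proof (induction m rule: int_induct[where k = 0])
  case (step1 i)
  then show ?case using P_Suc[OF x, of "i + n"] P_Suc[OF P_in[OF x], of i n] by (simp add: algebra_simps)
next
  case (step2 i)
  then show ?case using P_pred[OF x, of "i + n"] P_pred[OF P_in[OF x], of i n] by (simp add: algebra_simps)
qed simp

lemma pre_events [simp, intro]: "A \<in> events \<Longrightarrow> pre n A \<in> events"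
  unfolding pre_def using P_measurable by (rule measurable_sets)

lemma pre_add: "pre m (pre n A) = pre (n + m) A"
  unfolding pre_def using P_add P_in by auto

lemma pre_0: "A \<in> events \<Longrightarrow> pre 0 A = A"
  unfolding pre_def using sets.sets_into_space by auto

lemma pre_Int: "pre n (A \<inter> B) = pre n A \<inter> pre n B"
  unfolding pre_def by auto

lemma pre_INT: "J \<noteq> {} \<Longrightarrow> pre n (\<Inter>t\<in>J. A t) = (\<Inter>t\<in>J. pre n (A t))"
  unfolding pre_def by auto

lemma image_P: assumes A: "A \<in> events" shows "P n ` A = pre (- n) A"
proof -
  have sub: "A \<subseteq> X" using A by (rule sets.sets_into_space)
  have inv: "P (- n) (P n x) = x" "P n (P (- n) x) = x" if "x \<in> X" for x
    using P_add[OF that, of "- n" n] P_add[OF that, of n "- n"] by auto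
  show ?thesis
  proof (intro equalityI subsetI)
    fix y assume "y \<in> pre (- n) A"
    then have "y = P n (P (- n) y)" "P (- n) y \<in> A" using inv by (auto simp: pre_def)
    then show "y \<in> P n ` A" by blast
  qed (use sub inv P_in in \<open>auto simp: pre_def\<close>)
qed

lemma prob_pre [simp]: assumes A: "A \<in> events" shows "prob (pre n A) = prob A"
proof -
  have 1: "prob (pre 1 B) = prob B" if B: "B \<in> events" for B
  proof -
    have "prob B = measure (distr M M T) B" by (simp add: T_preserves)
    also have "\<dots> = prob (T -` B \<inter> X)" by (rule measure_distr[OF T_measurable B])
    finally show ?thesis by (simp add: pre_def int_pow_on_def)
  qed
  have step: "prob (pre (i + 1) A) = prob (pre i A)" for i
    using 1[of "pre i A"] A by (simp add: pre_add)
  show ?thesis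
  proof (induction n rule: int_induct[where k = 0])
    case (step2 i) then show ?case using step[of "i - 1"] by simp
  qed (use A step in \<open>auto simp: pre_0\<close>)
qed

lemma prob_Int_pre:
  assumes "A \<in> events" "B \<in> events"
  shows "prob (pre m A \<inter> pre n B) = prob (A \<inter> pre (n - m) B)"
proof -
  have "pre m A \<inter> pre n B = pre m (A \<inter> pre (n - m) B)" by (simp add: pre_Int pre_add)
  moreover have "A \<inter> pre (n - m) B \<in> events" using assms by blast
  ultimately show ?thesis by simp
qed

end

section \<open>Strong mixing implies multiple mixing along sums\<close>

lemma pairwise_eventually_set:
  fixes R :: "nat \<Rightarrow> nat \<Rightarrow> bool"
  assumes ev: "\<And>i. eventually (R i) sequentially"
  shows "\<exists>I. finite I \<and> card I = N \<and> (\<forall>i\<in>I. K < i) \<and> (\<forall>i\<in>I. \<forall>j\<in>I. i < j \<longrightarrow> R i j)"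
proof (induction N)
  case 0
  show ?case by (rule exI[of _ "{}"]) simp
next
  case (Suc N)
  then obtain I where I: "finite I" "card I = N" "\<forall>i\<in>I. K < i" "\<forall>i\<in>I. \<forall>j\<in>I. i < j \<longrightarrow> R i j"
    by blast
  have "\<forall>\<^sub>F n in sequentially. (\<forall>i\<in>I. R i n) \<and> Max (insert K I) < n"
    using eventually_ball_finite[OF I(1), of "\<lambda>n i. R i n" sequentially] ev
    by (intro eventually_conj[OF _ eventually_gt_at_top]) blast
  then obtain n where n: "\<forall>i\<in>I. R i n" "Max (insert K I) < n"
    using eventually_happens'[OF sequentially_bot] by blast
  then have less: "i < n" if "i \<in> insert K I" for i
    using I(1) that by (meson Max_ge finite_insert le_less_trans)
  then have "n \<notin> I" by blast
  then have "finite (insert n I)" "card (insert n I) = Suc N" "\<forall>i\<in>insert n I. K < i"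
    using I less by auto
  moreover have "\<forall>i\<in>insert n I. \<forall>j\<in>insert n I. i < j \<longrightarrow> R i j"
    using I(4) n(1) less by (metis insert_iff less_asym less_irrefl)
  ultimately show ?case by blast
qed

context invertible_mps
begin

lemma strongly_mixing_iff_pre:
  "strongly_mixing M T \<longleftrightarrow>
    (\<forall>A\<in>events. \<forall>B\<in>events. ((\<lambda>n::int. prob (A \<inter> pre n B)) \<longlongrightarrow> prob A * prob B) (filtercomap abs at_top))"
proof -
  have flim: "filterlim uminus (filtercomap abs at_top) (filtercomap (abs :: int \<Rightarrow> int) at_top)"
    unfolding filterlim_filtercomap_iff by (simp add: filterlim_filtercomap o_def)
  have neg: "((\<lambda>n::int. f (- n)) \<longlongrightarrow> L) (filtercomap abs at_top)"
    if "(f \<longlongrightarrow> L) (filtercomap abs at_top)" for f :: "int \<Rightarrow> real" and L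
    using filterlim_compose[OF that flim] .
  have iff: "((\<lambda>n::int. f (- n)) \<longlongrightarrow> L) (filtercomap abs at_top) \<longleftrightarrow> (f \<longlongrightarrow> L) (filtercomap abs at_top)"
    for f :: "int \<Rightarrow> real" and L
    using neg[of f L] neg[of "\<lambda>n. f (- n)" L] by auto
  show ?thesis
    unfolding strongly_mixing_def
    using iff[of "\<lambda>n. prob (_ \<inter> pre n _)"] by (simp add: image_P)
qed

text \<open>
  The form of mixing that applies to a pair of events moved by \<open>c * s k\<close> and by a fixed power \<open>d\<close>.
\<close>

lemma strongly_mixing_tendsto_seq:
  assumes mixing: "strongly_mixing M T" and A: "A \<in> events" "B \<in> events"
    and s: "filterlim (\<lambda>k. \<bar>s k\<bar>) at_top F" and c: "c \<noteq> 0"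
  shows "((\<lambda>k. prob (A \<inter> pre (d - c * s k) B)) \<longlongrightarrow> prob A * prob B) F"
proof -
  have "filterlim (\<lambda>k. d - c * s k) (filtercomap abs at_top) F"
    unfolding filterlim_filtercomap_iff o_def
  proof (rule filterlim_at_top_mono)
    show "filterlim (\<lambda>k. - \<bar>d\<bar> + \<bar>s k\<bar>) at_top F"
      unfolding filterlim_at_top
    proof
      fix Z
      have "\<forall>\<^sub>F k in F. Z + \<bar>d\<bar> \<le> \<bar>s k\<bar>" using s unfolding filterlim_at_top by blast
      then show "\<forall>\<^sub>F k in F. Z \<le> - \<bar>d\<bar> + \<bar>s k\<bar>" by (rule eventually_mono) linarith
    qed
    have "- \<bar>d\<bar> + \<bar>s k\<bar> \<le> \<bar>d - c * s k\<bar>" for k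
    proof -
      have "1 * \<bar>s k\<bar> \<le> \<bar>c\<bar> * \<bar>s k\<bar>" using c by (intro mult_right_mono) auto
      then show ?thesis using abs_triangle_ineq2[of "c * s k" d] by (simp add: abs_mult abs_minus_commute)
    qed
    then show "\<forall>\<^sub>F k in F. - \<bar>d\<bar> + \<bar>s k\<bar> \<le> \<bar>d - c * s k\<bar>" by simp
  qed
  moreover have "((\<lambda>n. prob (A \<inter> pre n B)) \<longlongrightarrow> prob A * prob B) (filtercomap abs at_top)"
    using mixing A unfolding strongly_mixing_iff_pre by blast
  ultimately show ?thesis by (rule filterlim_compose[rotated])
qed

text \<open>
  Of the exponents \<open>b t\<close> only the differences matter, so that all positions \<open>t\<close> play symmetric roles
  and one of them, \<open>j0\<close>, can be singled out as the test event of the Bessel argument. The tuples form a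
  finite family \<open>F\<close>, served by the same indices \<open>k\<close>, because one tuple at level \<open>m + 1\<close> needs the
  pairwise intersections of \<open>N\<close> translated tuples to be controlled simultaneously at level \<open>m\<close>. The
  bound \<open>K\<close> lets the later indices be chosen above the first one.
\<close>

theorem strongly_mixing_imp_multiple_mixing_along_sums:
  fixes b :: "'i \<Rightarrow> int" and F :: "('i \<Rightarrow> 'a set) set" and s :: "nat \<Rightarrow> nat \<Rightarrow> int"
  assumes mixing: "strongly_mixing M T"
  shows "\<lbrakk>finite J; card J = Suc m; inj_on b J; finite F; \<forall>A\<in>F. \<forall>t\<in>J. A t \<in> events;
      \<forall>j\<in>{1..m}. filterlim (\<lambda>k. \<bar>s j k\<bar>) at_top sequentially; 0 < \<epsilon>\<rbrakk>
    \<Longrightarrow> \<exists>k. strict_mono_on {1..m} k \<and> (\<forall>j\<in>{1..m}. K < k j) \<and>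
       (\<forall>A\<in>F. \<bar>prob (\<Inter>t\<in>J. pre (b t * (\<Sum>j=1..m. s j (k j))) (A t)) - (\<Prod>t\<in>J. prob (A t))\<bar> < \<epsilon>)"
proof (induction m arbitrary: J b F s \<epsilon> K)
  case 0
  then obtain t where "J = {t}" by (auto simp: card_Suc_eq)
  then show ?case using 0 by (auto simp: pre_0)
next
  case (Suc m)
  have evJ: "\<And>A t. A \<in> F \<Longrightarrow> t \<in> J \<Longrightarrow> A t \<in> events" using Suc.prems(5) by blast
  have s1: "filterlim (\<lambda>k. \<bar>s 1 k\<bar>) at_top sequentially" using Suc.prems(6) by simp
  obtain j0 where j0: "j0 \<in> J" using Suc.prems(2) by (metis card.empty ex_in_conv nat.distinct(1))
  define J' where "J' = J - {j0}"
  have J': "finite J'" "card J' = Suc m" "J' \<subseteq> J"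
    using Suc.prems(1,2) j0 by (auto simp: J'_def)
  then have "J' \<noteq> {}" by auto
  \<comment> \<open>the exponents that remain after translating the whole intersection so that the event at
    \<open>j0\<close> stands still\<close>
  define \<beta> where "\<beta> t = b t - b j0" for t
  have inj: "inj_on \<beta> J'" using Suc.prems(3) J'(3) by (auto simp: \<beta>_def inj_on_def)
  have nz: "\<beta> t \<noteq> 0" if "t \<in> J'" for t
    using that Suc.prems(3) j0 by (auto simp: J'_def \<beta>_def inj_on_def)
  define c where "c A = (\<Prod>t\<in>J'. prob (A t))" for A :: "'i \<Rightarrow> 'a set"
  have c01: "0 \<le> c A" "c A \<le> 1" for A by (auto simp: c_def intro: prod_nonneg prod_le_1)
  have ev: "A t \<in> events" if "A \<in> F" "t \<in> J'" for A t using evJ J'(3) that by blast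
  \<comment> \<open>the events whose translates by \<open>m\<close> make up the intersection of two of the \<open>V\<close> below; on the
    diagonal \<open>i = i'\<close> they describe \<open>V A i\<close> itself\<close>
  define W where "W A i i' = (\<lambda>t. pre (\<beta> t * s 1 i) (A t) \<inter> pre (\<beta> t * s 1 i') (A t))" for A :: "'i \<Rightarrow> 'a set" and i i'
  have W_ev: "W A i i' t \<in> events" if "A \<in> F" "t \<in> J'" for A i i' t
    using ev[OF that] by (auto simp: W_def)
  \<comment> \<open>one index \<open>i\<close> has to serve all tuples, so the averages are summed over \<open>F\<close>; the \<open>+ 1\<close> makes the
    final inequality strict and covers an empty \<open>F\<close>\<close>
  define e where "e = \<epsilon> / (card F + 1)"
  have e: "0 < e" using Suc.prems(7) by (simp add: e_def)
  obtain N :: nat and \<delta> :: real where N: "0 < N" and \<delta>: "0 < \<delta>" and bessel: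
    "\<forall>(I :: nat set) V c. \<forall>G\<in>events. finite I \<and> card I = N \<and> quasi_independent I V c \<delta>
      \<longrightarrow> (\<Sum>i\<in>I. \<bar>prob (V i \<inter> G) - c * prob G\<bar>) < e * N"
    using quasi_independent_events_small_correlation[OF e, where 'i = nat] by blast
  \<comment> \<open>half of the tolerance \<open>\<delta>\<close> is for the choice of the values of the first index, the other half
    for the induction hypothesis\<close>
  define R where "R i i' \<longleftrightarrow> (\<forall>A\<in>F. \<bar>(\<Prod>t\<in>J'. prob (W A i i' t)) - (c A)\<^sup>2\<bar> < \<delta> / 2)" for i i'
  have "eventually (R i) sequentially" for i
    unfolding R_def
  proof (intro eventually_ball_finite Suc.prems(4) ballI)
    fix A assume A: "A \<in> F"
    have "(\<lambda>i'. prob (W A i i' t)) \<longlonglongrightarrow> prob (A t) * prob (A t)" if t: "t \<in> J'" for t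
    proof -
      have "prob (W A i i' t) = prob (A t \<inter> pre (\<beta> t * s 1 i - \<beta> t * s 1 i') (A t))" for i'
        using prob_Int_pre[OF ev[OF A t] ev[OF A t], of "\<beta> t * s 1 i'" "\<beta> t * s 1 i"]
        by (simp add: W_def Int_commute)
      then show ?thesis
        using strongly_mixing_tendsto_seq[OF mixing ev[OF A t] ev[OF A t] s1 nz[OF t], of "\<beta> t * s 1 i"]
        by simp
    qed
    then have "(\<lambda>i'. \<Prod>t\<in>J'. prob (W A i i' t)) \<longlonglongrightarrow> (\<Prod>t\<in>J'. prob (A t) * prob (A t))"
      by (rule tendsto_prod)
    then have "(\<lambda>i'. \<Prod>t\<in>J'. prob (W A i i' t)) \<longlonglongrightarrow> (c A)\<^sup>2"
      by (simp add: c_def power2_eq_square prod.distrib)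
    from tendstoD[OF this, of "\<delta> / 2"] \<delta>
    show "\<forall>\<^sub>F i' in sequentially. \<bar>(\<Prod>t\<in>J'. prob (W A i i' t)) - (c A)\<^sup>2\<bar> < \<delta> / 2"
      by (simp add: dist_real_def)
  qed
  from pairwise_eventually_set[of R N K, OF this]
  obtain I where I: "finite I" "card I = N" "\<forall>i\<in>I. K < i" and RI: "\<And>i j. i \<in> I \<Longrightarrow> j \<in> I \<Longrightarrow> i < j \<Longrightarrow> R i j"
    by blast
  have R_pair: "\<bar>(\<Prod>t\<in>J'. prob (W A i i' t)) - (c A)\<^sup>2\<bar> < \<delta> / 2" if "A \<in> F" "i \<in> I" "i' \<in> I" "i \<noteq> i'" for A i i'
  proof -
    have "W A i i' = W A i' i" by (auto simp: W_def)
    then show ?thesis using RI[of i i'] RI[of i' i] that unfolding R_def by (metis linorder_neqE_nat)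
  qed
  have R_single: "(\<Prod>t\<in>J'. prob (W A i i t)) = c A" if "A \<in> F" for A i
    unfolding c_def using ev[OF that] by (intro prod.cong) (auto simp: W_def)
  \<comment> \<open>the induction hypothesis is applied to all \<open>W\<close> at once, with indices beyond those in \<open>I\<close>\<close>
  define F' where "F' = (\<lambda>(A, i, i'). W A i i') ` (F \<times> I \<times> I)"
  have F': "finite F'" "\<forall>A\<in>F'. \<forall>t\<in>J'. A t \<in> events"
    using Suc.prems(4) I(1) W_ev by (auto simp: F'_def)
  have s': "\<forall>j\<in>{1..m}. filterlim (\<lambda>k. \<bar>s (Suc j) k\<bar>) at_top sequentially"
    using Suc.prems(6) by auto
  have \<delta>2: "0 < \<delta> / 2" using \<delta> by simp
  obtain k' where k': "strict_mono_on {1..m} k'" "\<forall>j\<in>{1..m}. Max (insert K I) < k' j"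
    and approx: "\<forall>A\<in>F'. \<bar>prob (\<Inter>t\<in>J'. pre (\<beta> t * (\<Sum>j=1..m. s (Suc j) (k' j))) (A t)) - (\<Prod>t\<in>J'. prob (A t))\<bar> < \<delta> / 2"
    using Suc.IH[OF J'(1,2) inj F' s' \<delta>2, of "Max (insert K I)"] by blast
  define n where "n = (\<Sum>j=1..m. s (Suc j) (k' j))"
  define V where "V A i = (\<Inter>t\<in>J'. pre (\<beta> t * (s 1 i + n)) (A t))" for A :: "'i \<Rightarrow> 'a set" and i
  have V_ev: "V A i \<in> events" if "A \<in> F" for A i
    unfolding V_def using J' \<open>J' \<noteq> {}\<close> ev[OF that] by (intro sets.finite_INT) auto
  have V_Int: "V A i \<inter> V A i' = (\<Inter>t\<in>J'. pre (\<beta> t * n) (W A i i' t))" for A i i'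
    unfolding V_def W_def by (auto simp: pre_Int pre_add distrib_left)
  have V_approx: "\<bar>prob (V A i \<inter> V A i') - (\<Prod>t\<in>J'. prob (W A i i' t))\<bar> < \<delta> / 2" if "A \<in> F" "i \<in> I" "i' \<in> I" for A i i'
  proof -
    have "W A i i' \<in> F'" using that by (force simp: F'_def)
    then show ?thesis using approx unfolding V_Int n_def by blast
  qed
  have sum_small: "(\<Sum>i\<in>I. \<bar>prob (V A i \<inter> A j0) - c A * prob (A j0)\<bar>) < e * N" if A: "A \<in> F" for A
  proof -
    have "\<bar>prob (V A i) - c A\<bar> \<le> \<delta>" if "i \<in> I" for i
      using V_approx[OF A that that] \<delta> by (simp add: R_single[OF A])
    moreover have "\<bar>prob (V A i \<inter> V A j) - (c A)\<^sup>2\<bar> \<le> \<delta>" if "i \<in> I" "j \<in> I" "i \<noteq> j" for i j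
      using V_approx[OF A that(1,2)] R_pair[OF A that] by linarith
    ultimately have "quasi_independent I (V A) (c A) \<delta>"
      unfolding quasi_independent_def using c01 V_ev[OF A] by blast
    then show ?thesis using bessel I(1,2) evJ[OF A j0] by blast
  qed
  have "\<exists>i\<in>I. (\<Sum>A\<in>F. \<bar>prob (V A i \<inter> A j0) - c A * prob (A j0)\<bar>) < \<epsilon>"
  proof (rule ccontr)
    assume "\<not> ?thesis"
    then have "\<epsilon> \<le> (\<Sum>A\<in>F. \<bar>prob (V A i \<inter> A j0) - c A * prob (A j0)\<bar>)" if "i \<in> I" for i
      using that by (simp add: not_less)
    then have "real (card I) * \<epsilon> \<le> (\<Sum>i\<in>I. \<Sum>A\<in>F. \<bar>prob (V A i \<inter> A j0) - c A * prob (A j0)\<bar>)"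
      by (intro sum_bounded_below)
    also have "\<dots> = (\<Sum>A\<in>F. \<Sum>i\<in>I. \<bar>prob (V A i \<inter> A j0) - c A * prob (A j0)\<bar>)"
      by (rule sum.swap)
    also have "\<dots> \<le> (\<Sum>A\<in>F. e * N)"
      using sum_small by (intro sum_mono) (simp add: less_imp_le)
    also have "\<dots> = (card F * e) * N" by simp
    also have "\<dots> < \<epsilon> * N"
      using N Suc.prems(7) by (intro mult_strict_right_mono) (simp_all add: e_def field_simps)
    finally show False using I(2) by simp
  qed
  then obtain i where i: "i \<in> I" and i_small: "(\<Sum>A\<in>F. \<bar>prob (V A i \<inter> A j0) - c A * prob (A j0)\<bar>) < \<epsilon>"
    by blast
  define k where "k j = (if j = 1 then i else k' (j - 1))" for j
  have sum_k: "(\<Sum>j=1..Suc m. s j (k j)) = s 1 i + n"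
  proof -
    have "(\<Sum>j=1..Suc m. s j (k j)) = s 1 (k 1) + (\<Sum>j=Suc 1..Suc m. s j (k j))"
      by (rule sum.atLeast_Suc_atMost) simp
    also have "(\<Sum>j=Suc 1..Suc m. s j (k j)) = (\<Sum>j=1..m. s (Suc j) (k (Suc j)))"
      by (rule sum.shift_bounds_cl_Suc_ivl)
    also have "\<dots> = n" unfolding n_def by (intro sum.cong) (auto simp: k_def)
    finally show ?thesis by (simp add: k_def)
  qed
  have gt: "K < k' j \<and> i < k' j" if "j \<in> {1..m}" for j
  proof -
    have "i \<le> Max (insert K I)" "K \<le> Max (insert K I)" using I(1) i by auto
    then show ?thesis using k'(2) that by fastforce
  qed
  have "strict_mono_on {1..Suc m} k"
  proof (rule strict_mono_onI)
    fix p q assume pq: "p \<in> {1..Suc m}" "q \<in> {1..Suc m}" "p < q"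
    then have q: "q - 1 \<in> {1..m}" by auto
    show "k p < k q"
    proof (cases "p = 1")
      case True then show ?thesis using pq gt[OF q] by (simp add: k_def)
    next
      case False
      then have "p - 1 \<in> {1..m}" "p - 1 < q - 1" using pq by auto
      then show ?thesis using strict_mono_onD[OF k'(1) _ q, of "p - 1"] False pq by (simp add: k_def)
    qed
  qed
  moreover have "\<forall>j\<in>{1..Suc m}. K < k j"
  proof
    fix j assume "j \<in> {1..Suc m}"
    then have "j = 1 \<or> j - 1 \<in> {1..m}" by auto
    then show "K < k j" using gt[of "j - 1"] i I(3) by (auto simp: k_def)
  qed
  moreover have "\<forall>A\<in>F. \<bar>prob (\<Inter>t\<in>J. pre (b t * (\<Sum>j=1..Suc m. s j (k j))) (A t)) - (\<Prod>t\<in>J. prob (A t))\<bar> < \<epsilon>"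
  proof
    fix A assume A: "A \<in> F"
    have J: "J = insert j0 J'" "j0 \<notin> J'" using j0 by (auto simp: J'_def)
    have "(\<Inter>t\<in>J. pre (b t * (s 1 i + n)) (A t)) = pre (b j0 * (s 1 i + n)) (V A i \<inter> A j0)"
      unfolding J V_def pre_Int pre_INT[OF \<open>J' \<noteq> {}\<close>] by (auto simp: pre_add \<beta>_def algebra_simps)
    then have "prob (\<Inter>t\<in>J. pre (b t * (\<Sum>j=1..Suc m. s j (k j))) (A t)) = prob (V A i \<inter> A j0)"
      unfolding sum_k using V_ev[OF A] evJ[OF A j0] by (simp add: sets.Int)
    moreover have "(\<Prod>t\<in>J. prob (A t)) = c A * prob (A j0)"
      using J J'(1) by (simp add: c_def)
    moreover have "\<bar>prob (V A i \<inter> A j0) - c A * prob (A j0)\<bar>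
        \<le> (\<Sum>A\<in>F. \<bar>prob (V A i \<inter> A j0) - c A * prob (A j0)\<bar>)"
      using A Suc.prems(4) by (intro member_le_sum) auto
    ultimately show "\<bar>prob (\<Inter>t\<in>J. pre (b t * (\<Sum>j=1..Suc m. s j (k j))) (A t)) - (\<Prod>t\<in>J. prob (A t))\<bar> < \<epsilon>"
      using i_small by simp
  qed
  ultimately show ?case by blast
qed

end

section \<open>Increasing tuples and \<open>\<Sigma>\<^sub>m\<close> sets\<close>

lemma sorted_list_of_set_strict_mono_image:
  fixes k :: "nat \<Rightarrow> nat"
  assumes "strict_mono_on {1..m} k"
  shows "sorted_list_of_set (k ` {1..m}) = map k [1..<Suc m]"
proof -
  have "sorted_wrt (<) (map k [1..<Suc m])"
    unfolding sorted_wrt_iff_nth_less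
    using strict_mono_onD[OF assms] by (auto simp del: upt_Suc)
  moreover have "set (map k [1..<Suc m]) = k ` {1..m}"
    by (auto simp del: upt_Suc)
  ultimately show ?thesis
    using strict_sorted_list_of_set[of "k ` {1..m}"] strict_sorted_equal
    by (metis finite_atLeastAtMost finite_imageI set_sorted_list_of_set)
qed

text \<open>
  An increasing tuple of length \<open>m\<close> is determined by its set of entries. Hence a property of tuples is a
  colouring of the \<open>m\<close>-element sets, and a homogeneous set for it, enumerated increasingly, is the
  required reindexing \<open>g\<close>. Entries below \<open>1\<close> are avoided because the indices of \<open>\<Sigma>\<^sub>m\<close> sets start
  from \<open>1\<close>.
\<close>

lemma Ramsey_increasing_tuples:
  fixes Q :: "(nat \<Rightarrow> nat) \<Rightarrow> bool"
  assumes local: "\<And>k k'. (\<And>j. j \<in> {1..m} \<Longrightarrow> k j = k' j) \<Longrightarrow> Q k \<longleftrightarrow> Q k'"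
  obtains g :: "nat \<Rightarrow> nat" where "strict_mono g" "\<And>i. 1 \<le> g i"
    "(\<forall>k. strict_mono_on {1..m} k \<longrightarrow> Q (g \<circ> k)) \<or> (\<forall>k. strict_mono_on {1..m} k \<longrightarrow> \<not> Q (g \<circ> k))"
proof -
  define f where "f Y = (if Q (\<lambda>j. sorted_list_of_set Y ! (j - 1)) then 0 else (1::nat))" for Y :: "nat set"
  have inf: "infinite {1::nat..}" by (rule infinite_Ici)
  have two: "\<forall>Y. Y \<subseteq> {1::nat..} \<and> finite Y \<and> card Y = m \<longrightarrow> f Y < 2" by (simp add: f_def)
  obtain Z t where Z: "Z \<subseteq> {1..}" "infinite Z"
    and t: "\<forall>Y. Y \<subseteq> Z \<and> finite Y \<and> card Y = m \<longrightarrow> f Y = t"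
    using Ramsey[OF inf two] by blast
  define g where "g = enumerate Z"
  have g: "strict_mono g" unfolding g_def using Z(2) by (rule strict_mono_enumerate)
  have gZ: "g i \<in> Z" for i unfolding g_def using Z(2) by (rule enumerate_in_set)
  have colour: "Q (g \<circ> k) \<longleftrightarrow> t = 0" if k: "strict_mono_on {1..m} k" for k
  proof -
    have gk: "strict_mono_on {1..m} (g \<circ> k)"
      using k g by (auto simp: strict_mono_on_def strict_mono_def)
    then have "card ((g \<circ> k) ` {1..m}) = m"
      using card_image[OF strict_mono_on_imp_inj_on] by (metis card_atLeastAtMost diff_Suc_1)
    then have "f ((g \<circ> k) ` {1..m}) = t"
      using gZ t[rule_format, of "(g \<circ> k) ` {1..m}"] by auto
    moreover have "Q (\<lambda>j. sorted_list_of_set ((g \<circ> k) ` {1..m}) ! (j - 1)) \<longleftrightarrow> Q (g \<circ> k)"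
    proof (rule local)
      fix j assume "j \<in> {1..m}"
      then have "j - 1 < length [1..<Suc m]" "[1..<Suc m] ! (j - 1) = j"
        by (auto simp: nth_upt simp del: upt_Suc)
      then show "sorted_list_of_set ((g \<circ> k) ` {1..m}) ! (j - 1) = (g \<circ> k) j"
        unfolding sorted_list_of_set_strict_mono_image[OF gk] by (simp only: nth_map)
    qed
    ultimately show ?thesis by (auto simp: f_def split: if_splits)
  qed
  show thesis
  proof (rule that[OF g])
    show "1 \<le> g i" for i using gZ[of i] Z(1) by auto
  qed (use colour in blast)
qed

text \<open>
  Freeze the first index at \<open>1\<close> and absorb its summand into the second sequence. The remaining
  indices move up by one, which keeps them above \<open>1\<close>.
\<close>

lemma is_Sigma_Suc_contains_is_Sigma:
  assumes E: "is_Sigma (Suc m) E" and m: "1 \<le> m"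
  shows "\<exists>E'\<subseteq>E. is_Sigma m E'"
proof -
  obtain s where s: "\<And>j. j \<in> {1..Suc m} \<Longrightarrow> filterlim (\<lambda>k. \<bar>s j k\<bar>) at_top sequentially"
    and E_eq: "E = {\<Sum>j=1..Suc m. s j (k j) | k. strict_mono_on {1..Suc m} k \<and> (\<forall>j\<in>{1..Suc m}. 1 \<le> k j)}"
    using E unfolding is_Sigma_def by blast
  define s' where "s' j k = (if j = 1 then s 1 1 else 0) + s (Suc j) (Suc k)" for j k
  define E' where "E' = {\<Sum>j=1..m. s' j (k j) | k. strict_mono_on {1..m} k \<and> (\<forall>j\<in>{1..m}. 1 \<le> k j)}"
  have "filterlim (\<lambda>k. \<bar>s' j k\<bar>) at_top sequentially" if j: "j \<in> {1..m}" for j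
    unfolding filterlim_at_top
  proof
    fix Z :: int
    have "filterlim (\<lambda>k. \<bar>s (Suc j) (Suc k)\<bar>) at_top sequentially"
      using filterlim_compose[OF s[of "Suc j"] filterlim_Suc] j by simp
    then have "\<forall>\<^sub>F k in sequentially. Z + \<bar>s 1 1\<bar> \<le> \<bar>s (Suc j) (Suc k)\<bar>"
      unfolding filterlim_at_top by blast
    then show "\<forall>\<^sub>F k in sequentially. Z \<le> \<bar>s' j k\<bar>"
      by (rule eventually_mono) (auto simp: s'_def)
  qed
  then have "is_Sigma m E'" unfolding is_Sigma_def E'_def by blast
  moreover have "E' \<subseteq> E"
  proof
    fix n assume "n \<in> E'"
    then obtain k where k: "strict_mono_on {1..m} k" "\<forall>j\<in>{1..m}. 1 \<le> k j" and n: "n = (\<Sum>j=1..m. s' j (k j))"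
      unfolding E'_def by blast
    define k' where "k' j = (if j = 1 then 1 else Suc (k (j - 1)))" for j
    have "strict_mono_on {1..Suc m} k'"
    proof (rule strict_mono_onI)
      fix p q assume pq: "p \<in> {1..Suc m}" "q \<in> {1..Suc m}" "p < q"
      then have q: "q - 1 \<in> {1..m}" by auto
      show "k' p < k' q"
      proof (cases "p = 1")
        case True
        have "1 \<le> k (q - 1)" using k(2) q by blast
        then show ?thesis using True pq by (auto simp: k'_def)
      next
        case False
        then have "p - 1 \<in> {1..m}" "p - 1 < q - 1" using pq by auto
        then show ?thesis using strict_mono_onD[OF k(1) _ q, of "p - 1"] False pq by (simp add: k'_def)
      qed
    qed
    moreover have "\<forall>j\<in>{1..Suc m}. 1 \<le> k' j" by (simp add: k'_def)
    moreover have "n = (\<Sum>j=1..Suc m. s j (k' j))"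
    proof -
      have "n = (\<Sum>j=1..m. if j = 1 then s 1 1 else 0) + (\<Sum>j=1..m. s (Suc j) (Suc (k j)))"
        unfolding n s'_def by (rule sum.distrib)
      also have "(\<Sum>j=1..m. if j = 1 then s 1 1 else 0) = s 1 (k' 1)"
        using m by (simp add: k'_def)
      also have "(\<Sum>j=1..m. s (Suc j) (Suc (k j))) = (\<Sum>j=1..m. s (Suc j) (k' (Suc j)))"
        by (intro sum.cong) (auto simp: k'_def)
      also have "\<dots> = (\<Sum>j=Suc 1..Suc m. s j (k' j))"
        by (rule sum.shift_bounds_cl_Suc_ivl[symmetric])
      also have "s 1 (k' 1) + \<dots> = (\<Sum>j=1..Suc m. s j (k' j))"
        by (rule sum.atLeast_Suc_atMost[symmetric]) simp
      finally show ?thesis .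
    qed
    ultimately show "n \<in> E" unfolding E_eq by blast
  qed
  ultimately show ?thesis by blast
qed

lemma is_Sigma_star_mono:
  assumes "is_Sigma_star m D" "1 \<le> m" "m \<le> m'"
  shows "is_Sigma_star m' D"
  using assms(3)
proof (induction m' rule: dec_induct)
  case (step n)
  have "D \<inter> E \<noteq> {}" if E: "is_Sigma (Suc n) E" for E
  proof -
    have "1 \<le> n" using step.hyps assms(2) by simp
    then obtain E' where "E' \<subseteq> E" "is_Sigma n E'" using is_Sigma_Suc_contains_is_Sigma[OF E] by blast
    then show ?thesis using step.IH unfolding is_Sigma_star_def by blast
  qed
  then show ?case unfolding is_Sigma_star_def by blast
qed (rule assms)

section \<open>Returns along \<open>\<Sigma>\<^sub>m\<close> sets imply strong mixing\<close>

context invertible_mps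
begin

text \<open>
  The factor \<open>c\<close> is present because the hypothesis of the theorem only speaks of the times
  \<open>a\<^sub>1 n\<close>; it is removed at the very end.
\<close>

definition mixing_returns :: "int \<Rightarrow> 'a set \<Rightarrow> 'a set \<Rightarrow> real \<Rightarrow> int set" where
  "mixing_returns c A B \<epsilon> = {n. \<bar>prob (A \<inter> pre (c * n) B) - prob A * prob B\<bar> < \<epsilon>}"

text \<open>
  Suppose that the times \<open>n\<^sub>1, \<dots>, n\<^sub>N\<close> come from \<open>N\<close> successive blocks of \<open>m\<close> indices. The events
  \<open>T\<^bsup>- c n\<^esup> B\<close> for these times are almost independent as soon as all \<open>n\<^sub>j - n\<^sub>i\<close> with \<open>i < j\<close> are good
  times for the pair \<open>B, B\<close>, and then one of the times is good for \<open>A, B\<close>. The differences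
  \<open>n\<^sub>j - n\<^sub>i\<close> lie in a \<open>\<Sigma>\<^bsub>2m\<^esub>\<close> set, given by the negated sequences followed by the original ones. On a
  homogeneous set of indices its elements are all good or all bad, and the second alternative
  contradicts the hypothesis.
\<close>

lemma Sigma_star_mixing_returns_halve:
  assumes A: "A \<in> events" and B: "B \<in> events" and \<epsilon>: "0 < \<epsilon>"
    and star: "\<And>\<delta>. 0 < \<delta> \<Longrightarrow> is_Sigma_star (m + m) (mixing_returns c B B \<delta>)"
  shows "is_Sigma_star m (mixing_returns c A B \<epsilon>)"
  unfolding is_Sigma_star_def
proof (intro allI impI)
  fix E assume "is_Sigma m E"
  then obtain s where s: "\<And>j. j \<in> {1..m} \<Longrightarrow> filterlim (\<lambda>k. \<bar>s j k\<bar>) at_top sequentially"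
    and E_eq: "E = {\<Sum>j=1..m. s j (k j) | k. strict_mono_on {1..m} k \<and> (\<forall>j\<in>{1..m}. 1 \<le> k j)}"
    unfolding is_Sigma_def by blast
  obtain N :: nat and \<delta> :: real where N: "0 < N" and \<delta>: "0 < \<delta>" and bessel:
    "\<forall>(I :: nat set) V c. \<forall>G\<in>events. finite I \<and> card I = N \<and> quasi_independent I V c \<delta>
      \<longrightarrow> (\<Sum>i\<in>I. \<bar>prob (V i \<inter> G) - c * prob G\<bar>) < \<epsilon> * N"
    using quasi_independent_events_small_correlation[OF \<epsilon>, where 'i = nat] by blast
  define t where "t j k = (if j \<le> m then - s j k else s (j - m) k)" for j k
  have t_lim: "filterlim (\<lambda>k. \<bar>t j k\<bar>) at_top sequentially" if "j \<in> {1..m + m}" for j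
  proof (cases "j \<le> m")
    case True then show ?thesis using s[of j] that by (simp add: t_def)
  next
    case False
    then have "j - m \<in> {1..m}" using that by auto
    then show ?thesis using s[of "j - m"] False by (simp add: t_def)
  qed
  define Q where "Q k \<longleftrightarrow> (\<Sum>j=1..m + m. t j (k j)) \<in> mixing_returns c B B \<delta>" for k :: "nat \<Rightarrow> nat"
  have "Q k \<longleftrightarrow> Q k'" if "\<And>j. j \<in> {1..m + m} \<Longrightarrow> k j = k' j" for k k'
    unfolding Q_def using that by (metis (no_types, lifting) sum.cong)
  then obtain g :: "nat \<Rightarrow> nat" where g: "strict_mono g" "\<And>i. 1 \<le> g i" and mono_Q:
    "(\<forall>k. strict_mono_on {1..m + m} k \<longrightarrow> Q (g \<circ> k)) \<or> (\<forall>k. strict_mono_on {1..m + m} k \<longrightarrow> \<not> Q (g \<circ> k))"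
    using Ramsey_increasing_tuples[of "m + m" Q] by blast
  have "\<not> (\<forall>k. strict_mono_on {1..m + m} k \<longrightarrow> \<not> Q (g \<circ> k))"
  proof -
    have "filterlim (\<lambda>k. \<bar>t j (g k)\<bar>) at_top sequentially" if "j \<in> {1..m + m}" for j
      using filterlim_compose[OF t_lim[OF that] filterlim_subseq[OF g(1)]] .
    then have "is_Sigma (m + m) {\<Sum>j=1..m + m. t j (g (k j)) | k. strict_mono_on {1..m + m} k \<and> (\<forall>j\<in>{1..m + m}. 1 \<le> k j)}"
      unfolding is_Sigma_def by (intro exI[of _ "\<lambda>j k. t j (g k)"]) blast
    then obtain k where "strict_mono_on {1..m + m} k" "(\<Sum>j=1..m + m. t j (g (k j))) \<in> mixing_returns c B B \<delta>"
      using star[OF \<delta>] unfolding is_Sigma_star_def by blast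
    then show ?thesis by (auto simp: Q_def)
  qed
  then have Q: "Q (g \<circ> k)" if "strict_mono_on {1..m + m} k" for k
    using mono_Q that by blast
  \<comment> \<open>\<open>g\<close> applied to \<open>i * m + 1, \<dots>, i * m + m\<close> is the \<open>i\<close>-th block of indices\<close>
  define n where "n i = (\<Sum>j=1..m. s j (g (i * m + j)))" for i
  have n_E: "n i \<in> E" for i
  proof -
    have "strict_mono_on {1..m} (\<lambda>j. g (i * m + j))"
      using g(1) by (auto simp: strict_mono_on_def strict_mono_def)
    then show ?thesis
      unfolding E_eq n_def using g(2) by (intro CollectI exI[of _ "\<lambda>j. g (i * m + j)"]) simp
  qed
  have pair: "\<bar>prob (pre (c * n i) B \<inter> pre (c * n i') B) - (prob B)\<^sup>2\<bar> < \<delta>" if "i < i'" for i i'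
  proof -
    define k where "k j = (if j \<le> m then i * m + j else i' * m + (j - m))" for j
    have "strict_mono_on {1..m + m} k"
    proof (rule strict_mono_onI)
      fix p q assume pq: "p \<in> {1..m + m}" "q \<in> {1..m + m}" "p < q"
      have "i * m + m \<le> i' * m" using mult_le_mono1[of "Suc i" i' m] that by simp
      then show "k p < k q" using pq by (auto simp: k_def)
    qed
    from Q[OF this] have "(\<Sum>j=1..m + m. t j (g (k j))) \<in> mixing_returns c B B \<delta>"
      by (simp add: Q_def)
    also have "(\<Sum>j=1..m + m. t j (g (k j))) = n i' - n i"
    proof -
      have "(\<Sum>j=1..m + m. t j (g (k j))) = (\<Sum>j=1..m. t j (g (k j))) + (\<Sum>j=m + 1..m + m. t j (g (k j)))"
        by (rule sum.ub_add_nat) simp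
      also have "(\<Sum>j=1..m. t j (g (k j))) = - n i"
        unfolding n_def sum_negf[symmetric] by (intro sum.cong) (auto simp: t_def k_def)
      also have "(\<Sum>j=m + 1..m + m. t j (g (k j))) = (\<Sum>j=1..m. t (j + m) (g (k (j + m))))"
        using sum.shift_bounds_cl_nat_ivl[of "\<lambda>j. t j (g (k j))" 1 m m] by (simp add: add.commute)
      also have "\<dots> = n i'"
        unfolding n_def by (intro sum.cong) (auto simp: t_def k_def)
      finally show ?thesis by simp
    qed
    finally show ?thesis
      using prob_Int_pre[OF B B, of "c * n i" "c * n i'"]
      by (simp add: mixing_returns_def right_diff_distrib power2_eq_square)
  qed
  have "quasi_independent {..<N} (\<lambda>i. pre (c * n i) B) (prob B) \<delta>"
    unfolding quasi_independent_def
  proof (intro conjI ballI impI)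
    fix i j :: nat assume "i \<noteq> j"
    then show "\<bar>prob (pre (c * n i) B \<inter> pre (c * n j) B) - (prob B)\<^sup>2\<bar> \<le> \<delta>"
      using pair[of i j] pair[of j i] by (cases "i < j") (auto simp: Int_commute)
  qed (use B \<delta> in auto)
  then have less: "(\<Sum>i<N. \<bar>prob (pre (c * n i) B \<inter> A) - prob B * prob A\<bar>) < \<epsilon> * N"
    using bessel[rule_format, OF A, of "{..<N}" "\<lambda>i. pre (c * n i) B" "prob B"] by simp
  have "\<exists>i<N. \<bar>prob (pre (c * n i) B \<inter> A) - prob B * prob A\<bar> < \<epsilon>"
  proof (rule ccontr)
    assume "\<not> ?thesis"
    then have "card {..<N} * \<epsilon> \<le> (\<Sum>i<N. \<bar>prob (pre (c * n i) B \<inter> A) - prob B * prob A\<bar>)"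
      by (intro sum_bounded_below) (metis lessThan_iff not_less)
    then show False using less by (simp add: mult.commute)
  qed
  then obtain i where "n i \<in> mixing_returns c A B \<epsilon>"
    by (auto simp: mixing_returns_def Int_commute mult.commute)
  then show "mixing_returns c A B \<epsilon> \<inter> E \<noteq> {}" using n_E by blast
qed

text \<open>
  The descent has to start from a power of two that is at least \<open>l\<close>, and \<open>2 ^ l\<close> is one.
\<close>

lemma Sigma_star_mixing_returns_1:
  assumes star: "\<And>A B \<epsilon>. A \<in> events \<Longrightarrow> B \<in> events \<Longrightarrow> 0 < \<epsilon> \<Longrightarrow> is_Sigma_star l (mixing_returns c A B \<epsilon>)"
    and l: "1 \<le> l"
    and "A \<in> events" "B \<in> events" "0 < \<epsilon>"
  shows "is_Sigma_star 1 (mixing_returns c A B \<epsilon>)"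
proof -
  have "\<forall>A\<in>events. \<forall>B\<in>events. \<forall>\<epsilon>>0. is_Sigma_star (2 ^ (l - r)) (mixing_returns c A B \<epsilon>)" if "r \<le> l" for r
    using that
  proof (induction r)
    case 0
    then show ?case using star l is_Sigma_star_mono[of l _ "2 ^ l"] by (simp add: less_imp_le)
  next
    case (Suc r)
    then have "2 ^ (l - r) = 2 ^ (l - Suc r) + (2 ^ (l - Suc r) :: nat)"
      by (metis Suc_diff_Suc Suc_le_lessD mult_2 power_Suc)
    then show ?case using Suc Sigma_star_mixing_returns_halve by (metis Suc_leD)
  qed
  from this[of l] assms(3-5) show ?thesis by simp
qed

text \<open>
  A sequence of bad times with absolute values tending to infinity would itself be a \<open>\<Sigma>\<^sub>1\<close> set without
  good times, so all but finitely many times are good. To pass from the multiples of \<open>c\<close> to all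
  integers, write \<open>n = c q + r\<close>: then \<open>n\<close> is good for \<open>A, B\<close> if \<open>q\<close> is good for \<open>A\<close> and the translate of
  \<open>B\<close> by \<open>r\<close>, and there are only finitely many remainders \<open>r\<close>.
\<close>

lemma strongly_mixing_if_Sigma_1_star:
  assumes star: "\<And>A B \<epsilon>. A \<in> events \<Longrightarrow> B \<in> events \<Longrightarrow> 0 < \<epsilon> \<Longrightarrow> is_Sigma_star 1 (mixing_returns c A B \<epsilon>)"
    and c: "c \<noteq> 0"
  shows "strongly_mixing M T"
proof -
  have cofinite: "\<exists>K. \<forall>q. K \<le> \<bar>q\<bar> \<longrightarrow> q \<in> mixing_returns c A B \<epsilon>"
    if AB: "A \<in> events" "B \<in> events" "0 < \<epsilon>" for A B \<epsilon>
  proof (rule ccontr)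
    assume "\<not> ?thesis"
    then have "\<forall>k::nat. \<exists>q. int k \<le> \<bar>q\<bar> \<and> q \<notin> mixing_returns c A B \<epsilon>" by blast
    then obtain q where q: "\<And>k::nat. int k \<le> \<bar>q k\<bar>" "\<And>k. q k \<notin> mixing_returns c A B \<epsilon>" by metis
    have "filterlim (\<lambda>k. \<bar>q k\<bar>) at_top sequentially"
      by (rule filterlim_at_top_mono[OF filterlim_int_sequentially]) (simp add: q)
    then have "is_Sigma 1 {\<Sum>j=1..1::nat. q (k j) | k. strict_mono_on {1..1} k \<and> (\<forall>j\<in>{1..1}. 1 \<le> k j)}"
      unfolding is_Sigma_def by (intro exI[of _ "\<lambda>_. q"] conjI ballI refl)
    then have "mixing_returns c A B \<epsilon> \<inter> {\<Sum>j=1..1::nat. q (k j) | k. strict_mono_on {1..1} k \<and> (\<forall>j\<in>{1..1}. 1 \<le> k j)} \<noteq> {}"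
      using star[OF AB] unfolding is_Sigma_star_def by blast
    then show False using q(2) by auto
  qed
  have "\<forall>\<^sub>F n in filtercomap abs at_top. \<bar>prob (A \<inter> pre n B) - prob A * prob B\<bar> < \<epsilon>"
    if AB: "A \<in> events" "B \<in> events" "0 < \<epsilon>" for A B \<epsilon>
  proof -
    have "\<forall>r. \<exists>K. \<forall>q. K \<le> \<bar>q\<bar> \<longrightarrow> q \<in> mixing_returns c A (pre r B) \<epsilon>"
      using cofinite[OF AB(1) pre_events[OF AB(2)] AB(3)] by blast
    then obtain K where K: "\<And>r q. K r \<le> \<bar>q\<bar> \<Longrightarrow> q \<in> mixing_returns c A (pre r B) \<epsilon>" by metis
    \<comment> \<open>\<open>mod\<close> takes the sign of \<open>c\<close>, so remainders of both signs are included\<close>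
    define L where "L = Max (K ` {-\<bar>c\<bar>..\<bar>c\<bar>})"
    have L: "K r \<le> L" if "\<bar>r\<bar> \<le> \<bar>c\<bar>" for r
      unfolding L_def using that by (intro Max_ge) (auto intro!: imageI)
    show ?thesis
      unfolding eventually_filtercomap_at_top_linorder
    proof (intro exI[of _ "\<bar>c\<bar> * (L + 1)"] allI impI)
      fix n :: int assume n: "\<bar>c\<bar> * (L + 1) \<le> \<bar>n\<bar>"
      have mod: "\<bar>n mod c\<bar> < \<bar>c\<bar>" using c by (rule abs_mod_less)
      have n_eq: "n = c * (n div c) + n mod c" by simp
      have "\<bar>n\<bar> \<le> \<bar>c * (n div c)\<bar> + \<bar>n mod c\<bar>"
        by (metis abs_triangle_ineq n_eq)
      then have "\<bar>c\<bar> * L < \<bar>c\<bar> * \<bar>n div c\<bar>" using n mod by (simp add: abs_mult distrib_left)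
      then have "L \<le> \<bar>n div c\<bar>" using c by simp
      then have "n div c \<in> mixing_returns c A (pre (n mod c) B) \<epsilon>"
        using K L[of "n mod c"] mod by (meson less_imp_le order_trans)
      then show "\<bar>prob (A \<inter> pre n B) - prob A * prob B\<bar> < \<epsilon>"
        using AB(2) by (simp add: mixing_returns_def pre_add)
    qed
  qed
  then show ?thesis
    unfolding strongly_mixing_iff_pre by (auto simp: tendsto_iff dist_real_def)
qed

section \<open>The two implications\<close>

lemma return_set_eq:
  assumes A: "\<forall>j\<in>{0..l}. A j \<in> events" and l: "1 \<le> l"
  shows "return_set M T l a \<epsilon> A = {n. \<bar>prob (A 0 \<inter> (\<Inter>j\<in>{1..l}. pre (- a j * n) (A j))) - (\<Prod>j=0..l. prob (A j))\<bar> < \<epsilon>}"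
proof -
  have "(\<Inter>j\<in>{1..l}. P (a j * n) ` A j) = (\<Inter>j\<in>{1..l}. pre (- a j * n) (A j))" for n
    using A image_P by (intro INF_cong) auto
  then show ?thesis unfolding return_set_def by simp
qed

lemma Sigma_star_return_set_imp_strongly_mixing:
  assumes star: "\<And>A \<epsilon>. (\<forall>j\<in>{0..l}. A j \<in> events) \<Longrightarrow> 0 < \<epsilon> \<Longrightarrow> is_Sigma_star l (return_set M T l a \<epsilon> A)"
    and l: "1 \<le> l" and a: "a 1 \<noteq> 0"
  shows "strongly_mixing M T"
proof (rule strongly_mixing_if_Sigma_1_star)
  show "- a 1 \<noteq> 0" using a by simp
  show "is_Sigma_star 1 (mixing_returns (- a 1) A B \<epsilon>)" if AB: "A \<in> events" "B \<in> events" "0 < \<epsilon>" for A B \<epsilon>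
  proof (rule Sigma_star_mixing_returns_1[OF _ l AB])
    fix A B and \<epsilon> :: real assume AB: "A \<in> events" "B \<in> events" "0 < \<epsilon>"
    define C where "C j = (if j = 0 then A else if j = 1 then B else X)" for j :: nat
    have C: "\<forall>j\<in>{0..l}. C j \<in> events" using AB by (simp add: C_def)
    have "(\<Inter>j\<in>{1..l}. pre (- a j * n) (C j)) = pre (- a 1 * n) B" for n
    proof -
      have "pre k X = X" for k using P_in by (auto simp: pre_def)
      moreover have "pre k B \<subseteq> X" for k by (auto simp: pre_def)
      ultimately show ?thesis using l by (force simp: C_def split: if_splits)
    qed
    moreover have "(\<Prod>j=0..l. prob (C j)) = (\<Prod>j\<in>{0,1}. prob (C j))"
      using l by (intro prod.mono_neutral_right) (auto simp: C_def prob_space)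
    ultimately have "return_set M T l a \<epsilon> C = mixing_returns (- a 1) A B \<epsilon>"
      unfolding return_set_eq[OF C l] by (simp add: mixing_returns_def C_def)
    then show "is_Sigma_star l (mixing_returns (- a 1) A B \<epsilon>)" using star[OF C AB(3)] by simp
  qed
qed

lemma strongly_mixing_imp_Sigma_star_return_set:
  assumes mixing: "strongly_mixing M T" and l: "1 \<le> l"
    and a: "inj_on a {1..l}" "\<forall>j\<in>{1..l}. a j \<noteq> 0"
    and A: "\<forall>j\<in>{0..l}. A j \<in> events" and \<epsilon>: "0 < \<epsilon>"
  shows "is_Sigma_star l (return_set M T l a \<epsilon> A)"
  unfolding is_Sigma_star_def
proof (intro allI impI)
  fix E assume "is_Sigma l E"
  then obtain s where s: "\<forall>j\<in>{1..l}. filterlim (\<lambda>k. \<bar>s j k\<bar>) at_top sequentially"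
    and E_eq: "E = {\<Sum>j=1..l. s j (k j) | k. strict_mono_on {1..l} k \<and> (\<forall>j\<in>{1..l}. 1 \<le> k j)}"
    unfolding is_Sigma_def by blast
  \<comment> \<open>preimages replace images, hence the sign; \<open>0\<close> is the exponent of \<open>A 0\<close>, and it differs from the
    others because all \<open>a j\<close> are non-zero\<close>
  define b where "b j = (if j = 0 then 0 else - a j)" for j
  have "inj_on b {0..l}"
  proof (rule inj_onI)
    fix x y assume xy: "x \<in> {0..l}" "y \<in> {0..l}" "b x = b y"
    have nz: "b j \<noteq> 0" if "j \<in> {0..l}" "j \<noteq> 0" for j
      using a(2) that by (auto simp: b_def)
    show "x = y"
    proof (cases "x = 0 \<or> y = 0")
      case True
      then show ?thesis using nz[OF xy(1)] nz[OF xy(2)] xy(3) b_def[of 0] by metis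
    next
      case False
      then show ?thesis using inj_onD[OF a(1), of x y] xy by (simp add: b_def)
    qed
  qed
  then obtain k where k: "strict_mono_on {1..l} k" "\<forall>j\<in>{1..l}. 0 < k j"
    and approx: "\<bar>prob (\<Inter>t\<in>{0..l}. pre (b t * (\<Sum>j=1..l. s j (k j))) (A t)) - (\<Prod>t=0..l. prob (A t))\<bar> < \<epsilon>"
    using strongly_mixing_imp_multiple_mixing_along_sums[OF mixing, of "{0..l}" l b "{A}" s \<epsilon> 0] A s \<epsilon> by auto
  define n where "n = (\<Sum>j=1..l. s j (k j))"
  have "n \<in> E" unfolding E_eq n_def using k by (force simp: Suc_le_eq)
  moreover have "(\<Inter>t\<in>{0..l}. pre (b t * n) (A t)) = A 0 \<inter> (\<Inter>j\<in>{1..l}. pre (- a j * n) (A j))"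
  proof -
    have "{0..l} = insert 0 {1..l}" by auto
    moreover have "pre (b 0 * n) (A 0) = A 0" using A by (simp add: b_def pre_0)
    moreover have "(\<Inter>t\<in>{1..l}. pre (b t * n) (A t)) = (\<Inter>j\<in>{1..l}. pre (- a j * n) (A j))"
      by (intro INF_cong) (auto simp: b_def)
    ultimately show ?thesis by simp
  qed
  then have "n \<in> return_set M T l a \<epsilon> A"
    using approx unfolding return_set_eq[OF A l] n_def by simp
  ultimately show "return_set M T l a \<epsilon> A \<inter> E \<noteq> {}" by blast
qed

end

theorem theorem1p4:
  fixes M :: "'a::metric_space measure" and T :: "'a \<Rightarrow> 'a"
    and l :: nat and a :: "nat \<Rightarrow> int"
  assumes "invertible_mps M T"
    and "1 \<le> l"
    and "inj_on a {1..l}"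
    and "\<forall>j\<in>{1..l}. a j \<noteq> 0"
  shows "strongly_mixing M T \<longleftrightarrow>
    (\<forall>A :: nat \<Rightarrow> 'a set. \<forall>\<epsilon> :: real.
       (\<forall>j\<in>{0..l}. A j \<in> sets M) \<and> 0 < \<epsilon> \<longrightarrow> is_Sigma_star l (return_set M T l a \<epsilon> A))"
proof -
  interpret invertible_mps M T by fact
  have "a 1 \<noteq> 0" using assms(2,4) by simp
  then show ?thesis
    using strongly_mixing_imp_Sigma_star_return_set[OF _ assms(2-4)]
      Sigma_star_return_set_imp_strongly_mixing[of l a] assms(2) by blast
qed

end
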